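(* In the insertion-only streaming model, given a connected $n$-node simple undirected graph $G$, for any $k \in [1, (n-5)/4]$, any single-pass randomized streaming algorithm that, with probability at least $2/3$, computes a spanning tree of $G$ with at least $\operatorname{leaf}(G)-k$ leaves requires $\Omega(n^2/k^2)$ bits of space.
   Context: Insertion-only streaming model: the edges of the input graph arrive as a stream of insertions, read sequentially; a single-pass algorithm reads the stream once. $\operatorname{leaf}(G)$ is the maximum number of leaves (degree-one nodes) of a spanning tree of $G$. *)

theory Defs
  imports "HOL-Probability.Probability_Measure"
begin

text \<open>
  A simple undirected graph on the node set \<open>{..<n}\<close> is given by its set of edges, each edge
  being a two-element set of nodes.
\<close>

definition simple_graph :: "nat \<Rightarrow> nat set set \<Rightarrow> bool" where
  "simple_graph n E \<longleftrightarrow> E \<subseteq> {{u, v} | u v. u < n \<and> v < n \<and> u \<noteq> v}"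

definition connected_graph :: "nat \<Rightarrow> nat set set \<Rightarrow> bool" where
  "connected_graph n E \<longleftrightarrow> (\<forall>u<n. \<forall>v<n. (u, v) \<in> {(x, y). {x, y} \<in> E}\<^sup>*)"

text \<open>A cycle is the list of its nodes in cyclic order, without repeating the first node.\<close>

definition graph_cycle :: "nat set set \<Rightarrow> nat list \<Rightarrow> bool" where
  "graph_cycle E p \<longleftrightarrow> 3 \<le> length p \<and> distinct p \<and>
     (\<forall>i<length p. {p ! i, p ! (Suc i mod length p)} \<in> E)"

definition spanning_tree :: "nat \<Rightarrow> nat set set \<Rightarrow> nat set set \<Rightarrow> bool" where
  "spanning_tree n E T \<longleftrightarrow> T \<subseteq> E \<and> connected_graph n T \<and> \<not> (\<exists>p. graph_cycle T p)"

definition degree :: "nat set set \<Rightarrow> nat \<Rightarrow> nat" where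
  "degree E v = card {e \<in> E. v \<in> e}"

definition num_leaves :: "nat \<Rightarrow> nat set set \<Rightarrow> nat" where
  "num_leaves n T = card {v. v < n \<and> degree T v = 1}"

definition leaf :: "nat \<Rightarrow> nat set set \<Rightarrow> nat" where
  "leaf n E = Max (num_leaves n ` {T. spanning_tree n E T})"

text \<open>
  Insertion-only stream of a connected simple graph: each edge is inserted exactly once,
  in an arbitrary order.
\<close>

definition graph_stream :: "nat \<Rightarrow> nat set set \<Rightarrow> nat set list \<Rightarrow> bool" where
  "graph_stream n E es \<longleftrightarrow>
     simple_graph n E \<and> connected_graph n E \<and> distinct es \<and> set es = E"

text \<open>
  A deterministic single-pass algorithm: its memory is a bit string, updated once per arriving
  edge; the answer (a set of edges) is computed from the memory after the last edge. Updates
  and answer are arbitrary functions, so time, uniformity and the work space used while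
  processing one edge are not restricted.
\<close>

record stream_alg =
  init :: "bool list"
  step :: "bool list \<Rightarrow> nat set \<Rightarrow> bool list"
  answer :: "bool list \<Rightarrow> nat set set"

definition memory :: "stream_alg \<Rightarrow> nat set list \<Rightarrow> bool list" where
  "memory A es = foldl (step A) (init A) es"

definition run :: "stream_alg \<Rightarrow> nat set list \<Rightarrow> nat set set" where
  "run A es = answer A (memory A es)"

text \<open>
  A randomized algorithm is a probability measure on deterministic algorithms: the random
  string is drawn in advance, can be read at any time and is not charged to the space. Algorithms
  that toss fresh coins while reading the stream are covered as well.
\<close>

definition uses_space :: "nat \<Rightarrow> stream_alg measure \<Rightarrow> nat \<Rightarrow> bool" where
  "uses_space n M s \<longleftrightarrow>
     (\<forall>A\<in>space M. \<forall>E es. graph_stream n E es \<longrightarrow>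
        (\<forall>i\<le>length es. length (memory A (take i es)) \<le> s))"

text \<open>
  Non-measurable sets have measure \<open>0\<close>, so the lower bound \<open>2/3\<close> also forces the success
  event to be measurable.
\<close>

definition computes_max_leaf_tree :: "nat \<Rightarrow> real \<Rightarrow> stream_alg measure \<Rightarrow> bool" where
  "computes_max_leaf_tree n k M \<longleftrightarrow>
     (\<forall>E es. graph_stream n E es \<longrightarrow>
        measure M {A \<in> space M. spanning_tree n E (run A es) \<and>
          real (num_leaves n (run A es)) \<ge> real (leaf n E) - k} \<ge> 2 / 3)"

end

theory Submission
  imports Defs
begin

text \<open>
  Reduction from one-way communication of the INDEX problem. Take \<open>t = \<lfloor>k\<rfloor> + 1\<close> disjoint copies of
  a bipartite graph on \<open>m\<close> row and \<open>m\<close> column nodes, \<open>m = \<Theta>(n/k)\<close>, in which row \<open>i\<close> and column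
  \<open>j\<close> are adjacent iff the bit \<open>(i, j)\<close> of Alice's \<open>m\<^sup>2\<close>-bit input is set. To query \<open>(i, j)\<close>, Bob joins
  a root to all nodes except the columns \<open>j\<close>, hangs a pendant node at each row node \<open>i\<close>, which makes
  this node internal in every spanning tree, and links each column node \<open>j\<close> to a detour node. If the
  bit is set, the column nodes \<open>j\<close> can be leaves below the rows \<open>i\<close>, so there is a spanning tree with
  \<open>n - 1 - t\<close> leaves; a tree using none of the \<open>t\<close> edges for the queried bit has one more internal
  node in each copy, hence loses \<open>t > k\<close> leaves. So the computed tree reveals the bit, and the memory
  contents after Alice's part must take exponentially many values in \<open>m\<^sup>2\<close>.
\<close>

subsection \<open>Spanning trees and leaves\<close>

lemma connected_graph_crossing_edge:
  assumes "connected_graph n T" "x \<in> S" "x < n" "y \<notin> S" "y < n"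
  obtains u v where "{u, v} \<in> T" "u \<in> S" "v \<notin> S"
proof -
  have "(x, y) \<in> {(x, y). {x, y} \<in> T}\<^sup>*"
    using assms unfolding connected_graph_def by blast
  then have "y \<in> S \<or> (\<exists>u v. {u, v} \<in> T \<and> u \<in> S \<and> v \<notin> S)"
    by (induction rule: rtrancl_induct) (use assms in auto)
  then show thesis using assms that by blast
qed

lemma connected_graphI_root:
  assumes "\<And>x. x < n \<Longrightarrow> (x, r) \<in> {(x, y). {x, y} \<in> E}\<^sup>*"
  shows "connected_graph n E"
proof -
  let ?R = "{(x, y). {x, y} \<in> E}"
  have "sym (?R\<^sup>*)"
    by (intro sym_rtrancl) (auto simp: sym_def insert_commute)
  then show ?thesis
    unfolding connected_graph_def using assms by (meson rtrancl_trans symD)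
qed

text \<open>The two neighbours in a cycle of a node of maximal rank would both be its unique
  lower neighbour.\<close>

lemma no_graph_cycle_if_ranked:
  fixes rank :: "nat \<Rightarrow> nat"
  assumes ne: "\<And>x y. {x, y} \<in> T \<Longrightarrow> rank x \<noteq> rank y"
    and uniq: "\<And>x y z. \<lbrakk>{x, y} \<in> T; {x, z} \<in> T; rank y < rank x; rank z < rank x\<rbrakk> \<Longrightarrow> y = z"
  shows "\<not> graph_cycle T p"
proof
  assume c: "graph_cycle T p"
  define L where "L = length p"
  have L: "3 \<le> L" and dist: "distinct p"
    and e: "\<And>i. i < L \<Longrightarrow> {p ! i, p ! (Suc i mod L)} \<in> T"
    using c unfolding graph_cycle_def L_def by auto
  obtain i where i: "i < L" and mx: "\<And>l. l < L \<Longrightarrow> rank (p ! l) \<le> rank (p ! i)"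
    using arg_max_nat_lemma[of "\<lambda>i. i < L" 0 "\<lambda>i. rank (p ! i)" "Suc (Max ((\<lambda>i. rank (p ! i)) ` {..<L}))"]
      L by (fastforce simp: less_Suc_eq_le intro!: Max_ge)
  define l where "l = (if i = 0 then L - 1 else i - 1)"
  define h where "h = Suc i mod L"
  have l: "l < L" "Suc l mod L = i" using i L by (auto simp: l_def)
  have h: "h < L" using L by (simp add: h_def)
  \<comment> \<open>Length at least 3 matters here: in a closed walk of length 2 the predecessor and
    successor of a node coincide.\<close>
  have "h \<noteq> l" using i L by (auto simp: h_def l_def mod_Suc split: if_splits)
  moreover have "{p ! i, p ! h} \<in> T" "{p ! i, p ! l} \<in> T"
    using e[OF i] e[OF l(1)] l(2) by (auto simp: h_def insert_commute)
  moreover from this have "rank (p ! h) < rank (p ! i)" "rank (p ! l) < rank (p ! i)"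
    using ne mx[OF h] mx[OF l(1)] by (metis order_le_less)+
  ultimately have "p ! h = p ! l" using uniq by blast
  then show False
    using dist h l(1) \<open>h \<noteq> l\<close> by (simp add: nth_eq_iff_index_eq L_def)
qed

lemma degree_ne_1:
  assumes "{x, y} \<in> T" "{x, z} \<in> T" "y \<noteq> z"
  shows "degree T x \<noteq> 1"
proof
  assume "degree T x = 1"
  then obtain e where "{e \<in> T. x \<in> e} = {e}"
    unfolding degree_def by (auto simp: card_1_singleton_iff)
  moreover have "{x, y} \<in> {e \<in> T. x \<in> e}" "{x, z} \<in> {e \<in> T. x \<in> e}"
    using assms(1,2) by simp_all
  ultimately have "{x, y} = e" "{x, z} = e" by (simp_all only: singleton_iff)
  then show False using assms(3) by (metis doubleton_eq_iff)
qed

lemma degree_eq_1: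
  assumes "{x, y} \<in> T" "\<And>e. e \<in> T \<Longrightarrow> x \<in> e \<Longrightarrow> e = {x, y}"
  shows "degree T x = 1"
proof -
  have "{e \<in> T. x \<in> e} = {{x, y}}"
  proof (intro equalityI subsetI)
    fix e assume "e \<in> {e \<in> T. x \<in> e}"
    then show "e \<in> {{x, y}}" using assms(2) by blast
  next
    fix e assume "e \<in> {{x, y}}"
    then show "e \<in> {e \<in> T. x \<in> e}" using assms(1) by simp
  qed
  then show ?thesis by (simp add: degree_def)
qed

lemma num_leaves_le_leaf:
  assumes "finite E" "spanning_tree n E T"
  shows "num_leaves n T \<le> leaf n E"
proof -
  have "{T. spanning_tree n E T} \<subseteq> Pow E" by (auto simp: spanning_tree_def)
  then have "finite {T. spanning_tree n E T}" using assms(1) finite_subset by blast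
  then show ?thesis unfolding leaf_def using assms(2) by (intro Max_ge) auto
qed

lemma num_leaves_le:
  assumes "W \<subseteq> {..<n}" "\<And>x. x \<in> W \<Longrightarrow> degree T x \<noteq> 1"
  shows "num_leaves n T \<le> n - card W"
proof -
  have "{v. v < n \<and> degree T v = 1} \<subseteq> {..<n} - W" using assms by auto
  then have "num_leaves n T \<le> card ({..<n} - W)"
    unfolding num_leaves_def by (intro card_mono) auto
  also have "\<dots> = n - card W" using assms(1) by (simp add: card_Diff_subset finite_subset)
  finally show ?thesis .
qed

lemma num_leaves_ge:
  assumes "finite W" "\<And>x. x < n \<Longrightarrow> x \<notin> W \<Longrightarrow> degree T x = 1"
  shows "n - card W \<le> num_leaves n T"
proof -
  have "n - card W \<le> card ({..<n} - W)" using diff_card_le_card_Diff[OF assms(1)] by (metis card_lessThan)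
  also have "\<dots> \<le> num_leaves n T"
    unfolding num_leaves_def using assms(2) by (intro card_mono) auto
  finally show ?thesis .
qed


subsection \<open>The INDEX problem\<close>

text \<open>The weight factors over the elements of \<open>Q\<close>: with \<open>Y\<close> fixed,
  one of the choices \<open>q\<close> in \<open>X\<close>, \<open>q\<close> not in \<open>X\<close>
  contributes \<open>w\<close> and the other 1. Expanding the product of the sums
  \<open>f q + g q\<close> gives the sum over all subsets.\<close>

lemma sum_Pow_agreement_weight:
  fixes w :: "'b::comm_semiring_1"
  assumes "finite Q"
  shows "(\<Sum>X\<in>Pow Q. w ^ card {q \<in> Q. q \<in> X \<longleftrightarrow> Y q}) = (1 + w) ^ card Q"
proof -
  define f g where "f = (\<lambda>q. if Y q then w else 1)" and "g = (\<lambda>q. if Y q then 1 else w)"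
  have "w ^ card {q \<in> Q. q \<in> X \<longleftrightarrow> Y q} = prod f X * prod g (Q - X)" if "X \<subseteq> Q" for X
  proof -
    have fin: "finite X" using that assms finite_subset by blast
    have "prod f X = w ^ card {q \<in> X. Y q}" "prod g (Q - X) = w ^ card {q \<in> Q - X. \<not> Y q}"
      using fin assms by (simp_all add: f_def g_def prod.If_cases Int_def)
    moreover have "{q \<in> Q. q \<in> X \<longleftrightarrow> Y q} = {q \<in> X. Y q} \<union> {q \<in> Q - X. \<not> Y q}"
      using that by auto
    then have "card {q \<in> Q. q \<in> X \<longleftrightarrow> Y q} = card {q \<in> X. Y q} + card {q \<in> Q - X. \<not> Y q}"
      using fin assms by (simp add: card_Un_disjoint disjoint_iff)
    ultimately show ?thesis by (simp add: power_add)
  qed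
  then have "(\<Sum>X\<in>Pow Q. w ^ card {q \<in> Q. q \<in> X \<longleftrightarrow> Y q}) = (\<Sum>X\<in>Pow Q. prod f X * prod g (Q - X))"
    by (intro sum.cong) auto
  also have "\<dots> = (\<Prod>q\<in>Q. f q + g q)" by (rule prod_add[OF assms, symmetric])
  also have "\<dots> = (\<Prod>q\<in>Q. 1 + w)" by (intro prod.cong) (auto simp: f_def g_def add.commute)
  finally show ?thesis by simp
qed

text \<open>An exponential moment bound: weight \<open>X\<close> by \<open>w = (6/5)\<^sup>3\<close> to the number of correctly
  decoded bits. Convexity bounds the total weight from below by \<open>2\<^sup>N (6/5)\<^bsup>2N\<^esup>\<close>, and each of the
  messages contributes at most \<open>(1 + w)\<^sup>N\<close>. Any base \<open>b\<close> with \<open>2 b\<^sup>2 > 1 + b\<^sup>3\<close> would do.\<close>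

lemma index_message_count:
  fixes enc :: "'a set \<Rightarrow> 'm" and dec :: "'m \<Rightarrow> 'a \<Rightarrow> bool"
  assumes Q: "finite Q" and S: "finite S" "enc ` Pow Q \<subseteq> S"
    and avg: "3 * (\<Sum>X\<in>Pow Q. card {q \<in> Q. q \<in> X \<longleftrightarrow> dec (enc X) q}) \<ge> 2 * card Q * 2 ^ card Q"
  shows "(360 / 341 :: real) ^ card Q \<le> card S"
proof -
  define N where "N = card Q"
  define b :: real where "b = 6 / 5"
  define a where "a X \<mu> = card {q \<in> Q. q \<in> X \<longleftrightarrow> dec \<mu> q}" for X \<mu>
  \<comment> \<open>The tangent of the convex function \<open>b ^ (3 * k)\<close> of
    \<open>k\<close> is taken at 2N/3, the guaranteed average number of correct bits, so the linear
    term is nonnegative after summation.\<close>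
  have tangent: "b ^ (2 * N) * (1 + ln b * (3 * real k - 2 * real N)) \<le> (b ^ 3) ^ k" for k
  proof -
    have "1 + ln b * (3 * real k - 2 * real N) \<le> exp (ln b * (3 * real k - 2 * real N))"
      by (rule exp_ge_add_one_self)
    also have "\<dots> = b powr (real (3 * k) - real (2 * N))"
      by (simp add: powr_def b_def mult.commute)
    also have "\<dots> = b ^ (3 * k) / b ^ (2 * N)"
      unfolding powr_diff by (subst (1 2) powr_realpow) (simp_all add: b_def)
    finally show ?thesis
      by (subst power_mult[symmetric], subst mult.commute, subst (asm) pos_le_divide_eq) (simp_all add: b_def)
  qed
  have "(\<Sum>X\<in>Pow Q. 3 * real (a X (enc X)) - 2 * real N) \<ge> 0"
  proof -
    have "real (3 * (\<Sum>X\<in>Pow Q. a X (enc X))) \<ge> real (2 * N * 2 ^ N)"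
      using avg unfolding a_def N_def by (simp only: of_nat_le_iff)
    then show ?thesis
      using Q by (simp add: sum_subtractf sum_distrib_left card_Pow N_def algebra_simps)
  qed
  then have "2 ^ N * b ^ (2 * N) \<le> 2 ^ N * b ^ (2 * N)
      + b ^ (2 * N) * ln b * (\<Sum>X\<in>Pow Q. 3 * real (a X (enc X)) - 2 * real N)"
    by (simp add: b_def)
  also have "\<dots> = (\<Sum>X\<in>Pow Q. b ^ (2 * N) * (1 + ln b * (3 * real (a X (enc X)) - 2 * real N)))"
    using Q by (simp add: card_Pow N_def sum.distrib sum_subtractf sum_distrib_left algebra_simps)
  also have "\<dots> \<le> (\<Sum>X\<in>Pow Q. (b ^ 3) ^ a X (enc X))"
    by (intro sum_mono tangent)
  also have "\<dots> \<le> (\<Sum>X\<in>Pow Q. \<Sum>\<mu>\<in>S. (b ^ 3) ^ a X \<mu>)"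
    using S by (intro sum_mono member_le_sum) (auto simp: b_def)
  also have "\<dots> = (\<Sum>\<mu>\<in>S. \<Sum>X\<in>Pow Q. (b ^ 3) ^ a X \<mu>)"
    by (rule sum.swap)
  also have "\<dots> = card S * (1 + b ^ 3) ^ N"
    unfolding a_def N_def by (simp add: sum_Pow_agreement_weight[OF Q])
  finally have "(2 * b ^ 2) ^ N \<le> card S * (1 + b ^ 3) ^ N"
    by (simp only: power_mult power_mult_distrib)
  then have "(2 * b ^ 2) ^ N / (1 + b ^ 3) ^ N \<le> card S"
    by (subst pos_divide_le_eq) (auto simp: b_def intro!: zero_less_power add_pos_pos)
  \<comment> \<open>At b = 6/5 this ratio is 2.88 / 2.728 = 360/341, which exceeds 1.\<close>
  moreover have "(2 * b ^ 2) ^ N / (1 + b ^ 3) ^ N = (360 / 341) ^ N"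
    unfolding power_divide[symmetric] by (simp add: b_def power2_eq_square power3_eq_cube)
  ultimately show ?thesis by (simp add: N_def)
qed

text \<open>A pure power of 4, though crude, has a logarithm proportional to \<open>s\<close>
  without an additive term.\<close>

lemma card_bool_lists_le: "card {l :: bool list. length l \<le> s} \<le> 4 ^ s"
proof -
  have "card {l :: bool list. length l \<le> s} = (\<Sum>i\<le>s. 2 ^ i)"
    using card_lists_length_le[of "UNIV :: bool set" s] by simp
  also have "\<dots> \<le> 4 ^ s"
  proof (induction s)
    case (Suc s)
    have "(2::nat) ^ s \<le> 4 ^ s" by (rule power_mono) auto
    then show ?case using Suc by simp
  qed simp
  finally show ?thesis .
qed

text \<open>The expected number of events that occur is at least \<open>p * card I\<close>, and some
  outcome reaches this mean. This is the averaging step that fixes the random string.\<close>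

lemma (in prob_space) exists_outcome_in_many_events:
  assumes "finite I" "\<And>i. i \<in> I \<Longrightarrow> p \<le> prob {x \<in> space M. P i x}" "0 < p"
  shows "\<exists>x\<in>space M. real (card {i \<in> I. P i x}) \<ge> p * card I"
proof -
  define F where "F x = (\<Sum>i\<in>I. indicator {x \<in> space M. P i x} x :: real)" for x
  \<comment> \<open>A non-measurable set would have measure 0, below \<open>p\<close>.\<close>
  have ev: "{x \<in> space M. P i x} \<in> events" if "i \<in> I" for i
    using assms(2)[OF that] \<open>0 < p\<close> measure_notin_sets by fastforce
  have int: "integrable M F"
    unfolding F_def using ev by (intro Bochner_Integration.integrable_sum) (auto simp: emeasure_eq_measure)
  have "p * card I \<le> (\<Sum>i\<in>I. prob {x \<in> space M. P i x})"
    using sum_mono[of I "\<lambda>_. p"] assms(2) by (simp add: mult.commute)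
  also have "\<dots> = expectation F"
    unfolding F_def using ev
    by (subst Bochner_Integration.integral_sum) (auto simp: emeasure_eq_measure intro!: sum.cong)
  finally have "\<not> expectation F < p * card I" by simp
  then have "\<not> (AE x in M. F x < p * card I)" using expectation_less[OF int] by blast
  then obtain x where x: "x \<in> space M" "p * card I \<le> F x"
    by (meson AE_I2 not_le)
  have "F x = card {i \<in> I. P i x}"
    using assms(1) x(1) by (simp add: F_def indicator_def Int_def sum.If_cases)
  then show ?thesis using x by auto
qed

subsection \<open>The gadget graph\<close>

text \<open>Node \<open>0\<close> is the root; the nodes beyond the \<open>t\<close> copies only fill up the graph to \<open>n\<close> nodes.\<close>

locale leaf_gadget =
  fixes n t m :: nat
  assumes t_ge_2: "2 \<le> t" and size: "t * (2 * m + 2) < n"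
begin

definition node :: "nat \<Rightarrow> nat \<Rightarrow> nat" where
  "node a c = Suc (a * (2 * m + 2) + c)"

abbreviation "pendant a \<equiv> node a 0"
abbreviation "detour a \<equiv> node a (Suc 0)"
abbreviation "row_node a i \<equiv> node a (Suc (Suc i))"
abbreviation "col_node a j \<equiv> node a (Suc (Suc (m + j)))"

definition copy :: "nat \<Rightarrow> nat set" where
  "copy a = node a ` {..<2 * m + 2}"

definition alice :: "(nat \<times> nat) set \<Rightarrow> nat set set" where
  "alice X = {{row_node a i, col_node a j} | a i j. a < t \<and> i < m \<and> j < m \<and> (i, j) \<in> X}"

text \<open>For \<open>c = 1\<close> (the detour nodes) this is Bob's part of the graph; for \<open>c\<close> the index of row \<open>i\<close> it
  is the spanning tree with many leaves that exists when the queried bit is set.\<close>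

definition star :: "nat \<Rightarrow> nat \<Rightarrow> nat \<Rightarrow> nat set set" where
  "star i j c = {{0, x} | x. 0 < x \<and> x < n \<and> (\<forall>a<t. x \<noteq> pendant a \<and> x \<noteq> col_node a j)}
     \<union> {{pendant a, row_node a i} | a. a < t} \<union> {{node a c, col_node a j} | a. a < t}"

abbreviation "bob i j \<equiv> star i j (Suc 0)"

lemma node_eq_iff [simp]:
  assumes "c < 2 * m + 2" "d < 2 * m + 2"
  shows "node a c = node b d \<longleftrightarrow> a = b \<and> c = d"
proof
  assume "node a c = node b d"
  then have e: "a * (2 * m + 2) + c = b * (2 * m + 2) + d" by (simp add: node_def)
  have "(a * (2 * m + 2) + c) div (2 * m + 2) = a" "(b * (2 * m + 2) + d) div (2 * m + 2) = b"
    using assms by (auto intro!: div_nat_eqI simp: algebra_simps)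
  then have "a = b" using e by simp
  then show "a = b \<and> c = d" using e by simp
qed simp

lemma node_neq_0 [simp]: "node a c \<noteq> 0" "0 \<noteq> node a c" "0 < node a c"
  by (simp_all add: node_def)

lemma node_less [simp]:
  assumes "a < t" "c < 2 * m + 2"
  shows "node a c < n"
proof -
  have "a * (2 * m + 2) + c < Suc a * (2 * m + 2)" using assms by simp
  also have "\<dots> \<le> t * (2 * m + 2)" using assms by (intro mult_le_mono1) simp
  finally show ?thesis using size by (simp add: node_def)
qed

lemma n_pos: "0 < n"
  using size by simp

lemma node_in_copy [simp]: "c < 2 * m + 2 \<Longrightarrow> node a c \<in> copy b \<longleftrightarrow> a = b"
  by (auto simp: copy_def)

lemma zero_notin_copy [simp]: "0 \<notin> copy a"
  by (auto simp: copy_def)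

lemma alice_edge_iff:
  "{x, y} \<in> alice X \<longleftrightarrow> (\<exists>a i j. a < t \<and> i < m \<and> j < m \<and> (i, j) \<in> X \<and>
     (x = row_node a i \<and> y = col_node a j \<or> y = row_node a i \<and> x = col_node a j))"
  unfolding alice_def by (auto simp: doubleton_eq_iff)

lemma star_edge_iff:
  "{x, y} \<in> star i j c \<longleftrightarrow>
     (x = 0 \<and> 0 < y \<and> y < n \<and> (\<forall>a<t. y \<noteq> pendant a \<and> y \<noteq> col_node a j)) \<or>
     (y = 0 \<and> 0 < x \<and> x < n \<and> (\<forall>a<t. x \<noteq> pendant a \<and> x \<noteq> col_node a j)) \<or>
     (\<exists>a<t. x = pendant a \<and> y = row_node a i \<or> y = pendant a \<and> x = row_node a i) \<or>
     (\<exists>a<t. x = node a c \<and> y = col_node a j \<or> y = node a c \<and> x = col_node a j)"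
  unfolding star_def by (auto simp: doubleton_eq_iff)

lemma star_edge_cases:
  assumes "e \<in> star i j c"
  obtains x where "e = {0, x}" "0 < x" "x < n" "\<forall>a<t. x \<noteq> pendant a \<and> x \<noteq> col_node a j"
  | a where "a < t" "e = {pendant a, row_node a i}"
  | a where "a < t" "e = {node a c, col_node a j}"
  using assms unfolding star_def by blast

text \<open>Under the conditions on \<open>c\<close>, \<open>node a c\<close> is a neighbour of the
  root, so every node reaches the root in at most two steps. The supergraph \<open>E\<close> allows
  use both for the tree itself and for the streamed graph.\<close>

lemma star_connected:
  assumes "i < m" "j < m" "c < 2 * m + 2" "c \<noteq> 0" "c \<noteq> Suc (Suc (m + j))" "star i j c \<subseteq> E"
  shows "connected_graph n E"
proof (rule connected_graphI_root)
  fix x assume x: "x < n"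
  let ?R = "{(x, y). {x, y} \<in> E}"
  have edge: "(x, y) \<in> ?R" if "{x, y} \<in> star i j c" for x y using assms(6) that by blast
  have mid: "(x, 0) \<in> ?R\<^sup>*" if "x < n" "\<forall>a<t. x \<noteq> pendant a \<and> x \<noteq> col_node a j" for x
    using that by (cases "x = 0") (auto intro!: r_into_rtrancl edge simp: star_edge_iff)
  show "(x, 0) \<in> ?R\<^sup>*"
  proof (cases "\<exists>a<t. x = pendant a \<or> x = col_node a j")
    case True
    then obtain a y where a: "a < t" "y = row_node a i \<or> y = node a c" "(x, y) \<in> ?R"
      using edge by (metis star_edge_iff)
    then have "(y, 0) \<in> ?R\<^sup>*" using assms by (intro mid) auto
    then show ?thesis using a(3) by (rule converse_rtrancl_into_rtrancl[rotated])
  next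
    case False
    then show ?thesis using x mid by blast
  qed
qed

section \<open>Spanning trees with many leaves\<close>

lemma star_spanning_tree:
  assumes "i < m" "j < m" "c < 2 * m + 2" "c \<noteq> 0" "c \<noteq> Suc (Suc (m + j))" "star i j c \<subseteq> E"
  shows "spanning_tree n E (star i j c)"
proof -
  \<comment> \<open>The rank is the depth below the root.\<close>
  define rank :: "nat \<Rightarrow> nat" where
    "rank x = (if x = 0 then 0 else if \<exists>a<t. x = pendant a \<or> x = col_node a j then 2 else 1)" for x
  have rank: "rank (pendant a) = 2" "rank (col_node a j) = 2"
    "rank (row_node a i) = 1" "rank (node a c) = 1" if "a < t" for a
    using that assms by (auto simp: rank_def)
  have mid: "rank x = 1" if "0 < x" "\<forall>a<t. x \<noteq> pendant a \<and> x \<noteq> col_node a j" for x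
    using that by (auto simp: rank_def)
  have r0: "rank 0 = 0" by (simp add: rank_def)
  have "\<not> graph_cycle (star i j c) p" for p
  proof (rule no_graph_cycle_if_ranked[where rank = rank])
    fix x y assume "{x, y} \<in> star i j c"
    then show "rank x \<noteq> rank y"
      unfolding star_edge_iff by (auto simp: rank mid r0)
  next
    \<comment> \<open>An explicit parent function: two lower neighbours of \<open>x\<close> both
      equal its value.\<close>
    have lower: "y = (if rank x = 1 then 0 else if \<exists>a<t. x = pendant a
        then row_node (THE a. x = pendant a) i else node (THE a. x = col_node a j) c)"
      if "{x, y} \<in> star i j c" "rank y < rank x" for x y
      using that assms unfolding star_edge_iff
      by (auto simp: rank mid r0)
    fix x y z assume "{x, y} \<in> star i j c" "{x, z} \<in> star i j c" "rank y < rank x" "rank z < rank x"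
    then show "y = z" using lower[of x y] lower[of x z] by simp
  qed
  then show ?thesis
    using star_connected[OF assms(1-5) order.refl] assms(6) by (simp add: spanning_tree_def)
qed

lemma star_num_leaves:
  assumes "i < m" "j < m"
  shows "n - Suc t \<le> num_leaves n (star i j (Suc (Suc i)))"
proof -
  \<comment> \<open>The only possible internal nodes: in each copy, row \<open>i\<close> is the
    parent of both the pendant and column \<open>j\<close>.\<close>
  define W where "W = insert 0 ((\<lambda>a. row_node a i) ` {..<t})"
  have "card W \<le> Suc t"
    unfolding W_def by (metis card_image_le card_insert_le_m1 card_lessThan diff_Suc_1 finite_lessThan zero_less_Suc)
  then have "n - Suc t \<le> n - card W" by simp
  also have "\<dots> \<le> num_leaves n (star i j (Suc (Suc i)))"
  proof (rule num_leaves_ge)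
    fix x assume x: "x < n" "x \<notin> W"
    show "degree (star i j (Suc (Suc i))) x = 1"
    proof (cases "\<exists>a<t. x = pendant a \<or> x = col_node a j")
      case True
      then obtain a where a: "a < t" "x = pendant a \<or> x = col_node a j" by blast
      show ?thesis
      proof (rule degree_eq_1)
        show "{x, row_node a i} \<in> star i j (Suc (Suc i))" using a by (auto simp: star_edge_iff)
        fix e assume "e \<in> star i j (Suc (Suc i))" "x \<in> e"
        then show "e = {x, row_node a i}"
          using a assms by (cases rule: star_edge_cases) auto
      qed
    next
      case False
      show ?thesis
      proof (rule degree_eq_1)
        show "{x, 0} \<in> star i j (Suc (Suc i))" using False x by (auto simp: star_edge_iff W_def)
        fix e assume "e \<in> star i j (Suc (Suc i))" "x \<in> e"
        then show "e = {x, 0}"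
          using False x by (cases rule: star_edge_cases) (auto simp: W_def)
      qed
    qed
  qed (simp add: W_def)
  finally show ?thesis .
qed

text \<open>Bob joins rows only to the root or pendants, and columns only to the root or detours.
  Hence concatenating the two edge lists inserts no edge twice.\<close>

lemma alice_bob_disjoint:
  assumes "i < m" "j < m"
  shows "alice X \<inter> bob i j = {}"
proof -
  have "e \<notin> bob i j" if e': "e \<in> alice X" for e
  proof
    assume e: "e \<in> bob i j"
    obtain a i' j' where a: "a < t" "i' < m" "j' < m" "e = {row_node a i', col_node a j'}"
      using e' unfolding alice_def by auto
    from e show False
      by (cases rule: star_edge_cases) (use a assms in \<open>auto simp: doubleton_eq_iff\<close>)
  qed
  then show ?thesis by blast
qed

lemma simple_graph_alice_bob:
  assumes "i < m" "j < m"
  shows "simple_graph n (alice X \<union> bob i j)"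
proof -
  have "\<exists>u v. e = {u, v} \<and> u < n \<and> v < n \<and> u \<noteq> v" if e: "e \<in> alice X" for e
  proof -
    obtain a i' j' where "a < t" "i' < m" "j' < m" "e = {row_node a i', col_node a j'}"
      using e unfolding alice_def by auto
    then show ?thesis by (intro exI[of _ "row_node a i'"] exI[of _ "col_node a j'"]) simp
  qed
  moreover have "\<exists>u v. e = {u, v} \<and> u < n \<and> v < n \<and> u \<noteq> v" if e: "e \<in> bob i j" for e
    using e
  proof (cases rule: star_edge_cases)
    case (1 x)
    then show ?thesis by (intro exI[of _ 0] exI[of _ x]) (use n_pos in simp)
  next
    case (2 a)
    then show ?thesis using assms by (intro exI[of _ "pendant a"] exI[of _ "row_node a i"]) simp
  next
    case (3 a)
    then show ?thesis using assms by (intro exI[of _ "detour a"] exI[of _ "col_node a j"]) simp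
  qed
  ultimately show ?thesis unfolding simple_graph_def by blast
qed

lemma finite_alice_bob:
  assumes "i < m" "j < m"
  shows "finite (alice X \<union> bob i j)"
  using simple_graph_alice_bob[OF assms] unfolding simple_graph_def
  by (rule finite_subset) (rule finite_subset[of _ "Pow {..<n}"], auto)

lemma connected_graph_alice_bob:
  assumes "i < m" "j < m"
  shows "connected_graph n (alice X \<union> bob i j)"
  using assms by (intro star_connected[of i j "Suc 0"]) auto

text \<open>Connectivity puts an edge of \<open>T\<close> across every cut that separates some nodes
  from the root. The cuts used are a whole copy, a pendant with or without its row node
  \<open>i\<close>, and column node \<open>j\<close> with or without one of its neighbours.\<close>

lemma num_leaves_without_query_edges:
  assumes ij: "i < m" "j < m"
    and T: "T \<subseteq> alice X \<union> bob i j" "connected_graph n T"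
    and no: "\<And>a. a < t \<Longrightarrow> {row_node a i, col_node a j} \<notin> T"
  shows "num_leaves n T \<le> n - Suc (2 * t)"
proof -
  note edge = alice_edge_iff star_edge_iff
  have TE: "{x, y} \<in> alice X \<or> {x, y} \<in> bob i j" if "{x, y} \<in> T" for x y
    using T(1) that by blast
  have cross: "\<exists>u v. {u, v} \<in> T \<and> u \<in> S \<and> v \<notin> S" if "x \<in> S" "x < n" "0 \<notin> S" for x S
    using connected_graph_crossing_edge[OF T(2) that n_pos] by metis
  \<comment> \<open>In each copy row \<open>i\<close> and one further node are internal; the root is internal as \<open>t \<ge> 2\<close>.\<close>
  have root: "\<exists>x \<in> copy a. {0, x} \<in> T" if a: "a < t" for a
  proof -
    obtain u v where uv: "{u, v} \<in> T" "u \<in> copy a" "v \<notin> copy a"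
      using cross[of "pendant a" "copy a"] a by auto
    have "v = 0"
      using TE[OF uv(1)] uv(2,3) ij unfolding edge by auto
    then show ?thesis using uv by (metis insert_commute)
  qed
  have pend: "degree T (row_node a i) \<noteq> 1" if a: "a < t" for a
  proof -
    have nb: "y = row_node a i" if "{pendant a, y} \<in> T" for y
      using TE[OF that] a ij unfolding edge by auto
    obtain y where "{pendant a, y} \<in> T"
      using cross[of "pendant a" "{pendant a}"] a by auto
    then have p: "{row_node a i, pendant a} \<in> T" using nb by (metis insert_commute)
    obtain u v where uv: "{u, v} \<in> T" "u \<in> {pendant a, row_node a i}" "v \<notin> {pendant a, row_node a i}"
      using cross[of "pendant a" "{pendant a, row_node a i}"] a by auto
    then have "u = row_node a i" using nb by auto
    then show ?thesis using uv p by (intro degree_ne_1[of _ v _ "pendant a"]) auto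
  qed
  have extra: "\<exists>z \<in> copy a. z \<noteq> row_node a i \<and> degree T z \<noteq> 1" if a: "a < t" for a
  proof -
    \<comment> \<open>Column \<open>j\<close> is not joined to the root and, by \<open>no\<close>,
      not to row \<open>i\<close>; its neighbours in \<open>T\<close> are the detour or other rows
      of the same copy.\<close>
    have nb: "y \<in> copy a \<and> y \<noteq> row_node a i" if y: "{col_node a j, y} \<in> T" for y
    proof -
      have "y \<noteq> row_node a i" using no[OF a] y by (metis insert_commute)
      then show ?thesis using TE[OF y] a ij unfolding edge by auto
    qed
    obtain w where w: "{col_node a j, w} \<in> T" "w \<noteq> col_node a j"
      using cross[of "col_node a j" "{col_node a j}"] a ij by auto
    have "w \<noteq> 0" using nb[OF w(1)] by (metis zero_notin_copy)
    \<comment> \<open>The end \<open>u\<close> of the leaving edge is also joined to the other node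
      of the pair, so its degree is at least 2.\<close>
    then obtain u v where uv: "{u, v} \<in> T" "u \<in> {col_node a j, w}" "v \<notin> {col_node a j, w}"
      using cross[of "col_node a j" "{col_node a j, w}"] a ij by auto
    have "degree T u \<noteq> 1"
    proof (cases "u = w")
      case True
      then show ?thesis using uv w by (intro degree_ne_1[of _ v _ "col_node a j"]) (auto simp: insert_commute)
    next
      case False
      then show ?thesis using uv w by (intro degree_ne_1[of _ v _ w]) auto
    qed
    moreover have "u \<in> copy a \<and> u \<noteq> row_node a i" using uv(2) nb[OF w(1)] ij by auto
    ultimately show ?thesis by blast
  qed
  then obtain z where z: "\<And>a. a < t \<Longrightarrow> z a \<in> copy a \<and> z a \<noteq> row_node a i \<and> degree T (z a) \<noteq> 1"
    by metis
  define W where "W = insert 0 ((\<lambda>a. row_node a i) ` {..<t} \<union> z ` {..<t})"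
  have zcopy: "\<exists>c<2 * m + 2. z a = node a c" if "a < t" for a
    using z[OF that] by (auto simp: copy_def)
  have "card W = Suc (2 * t)"
  proof -
    have "inj_on (\<lambda>a. row_node a i) {..<t}" using ij by (auto simp: inj_on_def)
    moreover have "inj_on z {..<t}"
    proof (rule inj_onI)
      fix a b assume ab: "a \<in> {..<t}" "b \<in> {..<t}" "z a = z b"
      then show "a = b" using zcopy[of a] zcopy[of b] by auto
    qed
    moreover have "(\<lambda>a. row_node a i) ` {..<t} \<inter> z ` {..<t} = {}"
    proof -
      have "row_node a i \<noteq> z b" if "a < t" "b < t" for a b
        using z[OF that(2)] zcopy[OF that(2)] ij by auto
      then show ?thesis by auto
    qed
    moreover have "0 \<notin> (\<lambda>a. row_node a i) ` {..<t} \<union> z ` {..<t}"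
      using zcopy by fastforce
    ultimately show ?thesis by (simp add: W_def card_Un_disjoint card_image)
  qed
  moreover have "num_leaves n T \<le> n - card W"
  proof (rule num_leaves_le)
    show "W \<subseteq> {..<n}" using zcopy ij n_pos by (fastforce simp: W_def)
    obtain x y where xy: "x \<in> copy 0" "{0, x} \<in> T" "y \<in> copy 1" "{0, y} \<in> T"
      using root[of 0] root[of 1] t_ge_2 by auto
    then have "x \<noteq> y" by (auto simp: copy_def)
    then have "degree T 0 \<noteq> 1" using xy by (intro degree_ne_1[of _ x _ y]) auto
    then show "degree T x \<noteq> 1" if "x \<in> W" for x
      using that pend z unfolding W_def by auto
  qed
  ultimately show ?thesis by simp
qed

lemma query_bit_iff_edge_in_tree:
  assumes ij: "i < m" "j < m" and k: "k < real t"
    and T: "spanning_tree n (alice X \<union> bob i j) T"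
      "real (num_leaves n T) \<ge> real (leaf n (alice X \<union> bob i j)) - k"
  shows "(i, j) \<in> X \<longleftrightarrow> (\<exists>a<t. {row_node a i, col_node a j} \<in> T)"
proof
  have TE: "T \<subseteq> alice X \<union> bob i j" "connected_graph n T"
    using T(1) by (auto simp: spanning_tree_def)
  { assume "\<exists>a<t. {row_node a i, col_node a j} \<in> T"
    then obtain a where a: "a < t" "{row_node a i, col_node a j} \<in> alice X \<union> bob i j" using TE by blast
    then have "{row_node a i, col_node a j} \<in> alice X"
      using ij by (auto simp: star_edge_iff)
    then show "(i, j) \<in> X"
      using a ij unfolding alice_edge_iff by fastforce }
  assume q: "(i, j) \<in> X"
  show "\<exists>a<t. {row_node a i, col_node a j} \<in> T"
  proof (rule ccontr)
    assume "\<not> ?thesis"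
    then have ub: "num_leaves n T \<le> n - Suc (2 * t)"
      using num_leaves_without_query_edges[OF ij TE] by blast
    have sub: "star i j (Suc (Suc i)) \<subseteq> alice X \<union> bob i j"
      using q ij unfolding star_def alice_def by blast
    have "n - Suc t \<le> leaf n (alice X \<union> bob i j)"
      using num_leaves_le_leaf[OF finite_alice_bob[OF ij] star_spanning_tree[OF ij _ _ _ sub]] star_num_leaves[OF ij] ij
      by fastforce
    \<comment> \<open>This keeps the natural subtractions exact: n - 1 - t - k \<le> n - 1 - 2t
      would then force t \<le> k.\<close>
    moreover have "Suc (2 * t) \<le> n"
      using size by (simp add: algebra_simps)
    ultimately show False using ub T(2) k by linarith
  qed
qed

section \<open>From streaming to one-way communication\<close>

lemma space_bound:
  assumes "prob_space M" "computes_max_leaf_tree n k M" "uses_space n M s" "k < real t" "0 < m"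
  shows "(360 / 341 :: real) ^ (m * m) \<le> 4 ^ s"
proof -
  interpret prob_space M by fact
  define Q where "Q = {..<m} \<times> {..<m}"
  have Q: "finite Q" "card Q = m * m" by (simp_all add: Q_def card_cartesian_product)
  \<comment> \<open>Alice's edge order depends on \<open>X\<close> alone and Bob's on
    \<open>q\<close> alone, so the stream splits into two independent halves.\<close>
  have "\<exists>l. set l = alice X \<and> distinct l" for X
    using finite_alice_bob[OF \<open>0 < m\<close> \<open>0 < m\<close>, of X] by (intro finite_distinct_list) simp
  then obtain la where la: "\<And>X. set (la X) = alice X" "\<And>X. distinct (la X)"
    by metis
  have "\<exists>l. set l = bob (fst q) (snd q) \<and> distinct l" if "q \<in> Q" for q
    using that finite_alice_bob[of "fst q" "snd q"] by (intro finite_distinct_list) (auto simp: Q_def)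
  then obtain lb where lb: "\<And>q. q \<in> Q \<Longrightarrow> set (lb q) = bob (fst q) (snd q)"
      "\<And>q. q \<in> Q \<Longrightarrow> distinct (lb q)"
    by metis
  define G where "G X q = alice X \<union> bob (fst q) (snd q)" for X and q :: "nat \<times> nat"
  have gs: "graph_stream n (G X q) (la X @ lb q)" if q: "q \<in> Q" for X q
  proof -
    have ij: "fst q < m" "snd q < m" using q by (auto simp: Q_def)
    show ?thesis
      using simple_graph_alice_bob[OF ij] connected_graph_alice_bob[OF ij] alice_bob_disjoint[OF ij]
      by (simp add: graph_stream_def G_def la lb[OF q])
  qed
  define P where "P Xq A = (case Xq of (X, q) \<Rightarrow> spanning_tree n (G X q) (run A (la X @ lb q)) \<and>
      real (num_leaves n (run A (la X @ lb q))) \<ge> real (leaf n (G X q)) - k)" for Xq A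
  have success: "2 / 3 \<le> prob {A \<in> space M. P Xq A}" if Xq: "Xq \<in> Pow Q \<times> Q" for Xq
    using assms(2) gs Xq unfolding computes_max_leaf_tree_def P_def by (cases Xq) auto
  \<comment> \<open>Averaging over all inputs and queries fixes one deterministic algorithm that
    succeeds on two thirds of the pairs.\<close>
  have "\<exists>A\<in>space M. real (card {Xq \<in> Pow Q \<times> Q. P Xq A}) \<ge> 2 / 3 * card (Pow Q \<times> Q)"
    using Q(1) by (intro exists_outcome_in_many_events success) simp_all
  then obtain A where A: "A \<in> space M"
      "real (card {Xq \<in> Pow Q \<times> Q. P Xq A}) \<ge> 2 / 3 * card (Pow Q \<times> Q)"
    by blast
  \<comment> \<open>The message is the memory after Alice's half; the decoder resumes the algorithm
    from it on Bob's half.\<close>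
  define enc where "enc X = memory A (la X)" for X
  define dec where "dec \<mu> q = (\<exists>a<t. {row_node a (fst q), col_node a (snd q)}
      \<in> answer A (foldl (step A) \<mu> (lb q)))" for \<mu> q
  have run: "run A (la X @ lb q) = answer A (foldl (step A) (enc X) (lb q))" for X q
    by (simp add: run_def memory_def enc_def)
  have correct: "q \<in> X \<longleftrightarrow> dec (enc X) q" if "q \<in> Q" "P (X, q) A" for X q
    using that query_bit_iff_edge_in_tree[of "fst q" "snd q" k X "run A (la X @ lb q)"] assms(4)
    by (auto simp: P_def G_def Q_def run dec_def)
  have "{Xq \<in> Pow Q \<times> Q. P Xq A} \<subseteq> (SIGMA X:Pow Q. {q \<in> Q. q \<in> X \<longleftrightarrow> dec (enc X) q})"
    using correct by auto
  then have "card {Xq \<in> Pow Q \<times> Q. P Xq A}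
      \<le> card (SIGMA X:Pow Q. {q \<in> Q. q \<in> X \<longleftrightarrow> dec (enc X) q})"
    using Q(1) by (intro card_mono) auto
  also have "\<dots> = (\<Sum>X\<in>Pow Q. card {q \<in> Q. q \<in> X \<longleftrightarrow> dec (enc X) q})"
    using Q(1) by (intro card_SigmaI) auto
  finally have "2 / 3 * real (card (Pow Q \<times> Q))
      \<le> real (\<Sum>X\<in>Pow Q. card {q \<in> Q. q \<in> X \<longleftrightarrow> dec (enc X) q})"
    using A(2) by linarith
  then have "real (2 * card Q * 2 ^ card Q)
      \<le> real (3 * (\<Sum>X\<in>Pow Q. card {q \<in> Q. q \<in> X \<longleftrightarrow> dec (enc X) q}))"
    using Q(1) by (simp add: card_cartesian_product card_Pow algebra_simps)
  then have avg: "2 * card Q * 2 ^ card Q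
      \<le> 3 * (\<Sum>X\<in>Pow Q. card {q \<in> Q. q \<in> X \<longleftrightarrow> dec (enc X) q})"
    by (simp only: of_nat_le_iff)
  have mem: "enc X \<in> {l. length l \<le> s}" for X
  proof -
    \<comment> \<open>Space is bounded only along streams of connected graphs, so Alice's half is
      viewed as a prefix of the stream for an arbitrary query.\<close>
    have "(0, 0) \<in> Q" using assms(5) by (simp add: Q_def)
    from gs[OF this] have "length (memory A (take (length (la X)) (la X @ lb (0, 0)))) \<le> s"
      using assms(3) A(1) unfolding uses_space_def by (metis le_add1 length_append)
    then show ?thesis by (simp add: enc_def)
  qed
  have fin: "finite {l :: bool list. length l \<le> s}"
    using finite_lists_length_le[of "UNIV :: bool set" s] by simp
  have "(360 / 341 :: real) ^ card Q \<le> card {l :: bool list. length l \<le> s}"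
    using index_message_count[OF Q(1) fin _ avg] mem by blast
  also have "\<dots> \<le> real (4 ^ s)"
    using card_bool_lists_le by (simp only: of_nat_le_iff)
  finally show ?thesis by (simp add: Q(2))
qed

end

section \<open>Choice of parameters\<close>

theorem theorem17:
  shows "\<exists>c>0. \<forall>(n::nat) (k::real) (M :: stream_alg measure) (s::nat).
    1 \<le> k \<and> k \<le> (real n - 5) / 4 \<and> prob_space M \<and>
    computes_max_leaf_tree n k M \<and> uses_space n M s
    \<longrightarrow> real s \<ge> c * (real n)\<^sup>2 / k\<^sup>2"
proof (intro exI[of _ "ln (360 / 341) / (144 * ln 4)"] conjI allI impI)
  \<comment> \<open>144 is the square of the 12 in n/k \<le> 12m, and \<open>ln 4\<close> comes from
    the bound \<open>4 ^ s\<close> on the number of messages.\<close>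
  show "0 < ln (360 / 341) / (144 * ln 4 :: real)" by simp
next
  fix n :: nat and k :: real and M :: "stream_alg measure" and s :: nat
  assume *: "1 \<le> k \<and> k \<le> (real n - 5) / 4 \<and> prob_space M \<and>
    computes_max_leaf_tree n k M \<and> uses_space n M s"
  then have k: "1 \<le> k" "k \<le> (real n - 5) / 4" by simp_all
  \<comment> \<open>\<open>t\<close> is the least integer above \<open>k\<close>, \<open>y\<close>
    the number of non-root nodes available per copy, and \<open>m\<close> the largest size with 2m +
    2 \<le> y.\<close>
  define t where "t = Suc (nat \<lfloor>k\<rfloor>)"
  define y where "y = (n - 1) div t"
  define m where "m = (y - 2) div 2"
  have t: "2 \<le> t" "k < real t" "real t \<le> k + 1"
    using k(1) unfolding t_def by linarith+
  \<comment> \<open>The upper bound on \<open>k\<close> gives each copy at least four nodes, just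
    enough for m = 1.\<close>
  have "real (4 * t) \<le> real n - 1" using t(3) k(2) by (simp add: field_simps)
  then have "4 * t \<le> n - 1" by linarith
  then have y: "4 \<le> y" using t(1) by (simp add: y_def less_eq_div_iff_mult_less_eq)
  then have m: "1 \<le> m" "2 * m + 2 \<le> y" "y \<le> 5 * m" unfolding m_def by presburger+
  have "t * (2 * m + 2) \<le> t * y" using m(2) by (rule mult_le_mono2)
  also have "\<dots> \<le> n - 1" unfolding y_def by simp
  also have "n - 1 < n" using k by (cases n) auto
  finally have "leaf_gadget n t m" using t(1) by unfold_locales auto
  then have "(360 / 341 :: real) ^ (m * m) \<le> 4 ^ s"
    using leaf_gadget.space_bound[of n t m M k s] * t(2) m(1) by auto
  then have "ln ((360 / 341 :: real) ^ (m * m)) \<le> ln (4 ^ s)" by (subst ln_le_cancel_iff) auto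
  then have s: "real (m * m) * ln (360 / 341) \<le> s * ln 4" by (simp only: ln_realpow)
  \<comment> \<open>The 12 arises here: n \<le> t(y + 1) \<le> 6tm and t \<le> k + 1 \<le>
    2k.\<close>
  have "n - 1 < t * Suc y"
    unfolding y_def using t(1) dividend_less_times_div[of t "n - 1"] by simp
  also have "\<dots> \<le> t * (6 * m)" using m by (intro mult_le_mono2) simp
  finally have "n \<le> t * (6 * m)" by linarith
  then have "real n \<le> real (t * (6 * m))" by (simp only: of_nat_le_iff)
  then have "real n \<le> real t * (6 * real m)" by simp
  also have "\<dots> \<le> (2 * k) * (6 * real m)" using t k by (intro mult_right_mono) auto
  finally have "real n / k \<le> 12 * real m" using k by (simp add: field_simps)
  then have "(real n / k)\<^sup>2 \<le> (12 * real m)\<^sup>2" using k by (intro power_mono) auto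
  then have "(real n)\<^sup>2 / k\<^sup>2 / 144 \<le> real (m * m)"
    by (simp add: power_divide power_mult_distrib power2_eq_square)
  then have "(real n)\<^sup>2 / k\<^sup>2 / 144 * ln (360 / 341) \<le> real (m * m) * ln (360 / 341)"
    by (intro mult_right_mono) auto
  with s have "(real n)\<^sup>2 / k\<^sup>2 / 144 * ln (360 / 341) \<le> s * ln 4" by linarith
  then show "ln (360 / 341) / (144 * ln 4) * (real n)\<^sup>2 / k\<^sup>2 \<le> real s"
    using k by (simp add: field_simps)
qed

end
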